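(* Every countably infinite unbounded torsion Abelian group admits a complete Hausdorff minimally almost periodic group topology.
   Context: An Abelian group $G$ is unbounded if $\exp G=\infty$, where $\exp G$ is the least common multiple of the orders of the elements of $G$. For a topological Abelian group $X$, $X^\wedge$ is the group of continuous characters (continuous homomorphisms to the circle group) and $\mathbf{n}(X)=\bigcap_{\chi\in X^\wedge}\ker\chi$. $X$ (or its topology) is called minimally almost periodic (MinAP) if $\mathbf{n}(X)=X$, i.e. the only continuous character of $X$ is the trivial one. *)

theory Defs
  imports "HOL-Analysis.Analysis" "HOL-Algebra.Multiplicative_Group" "HOL-Library.Extended_Nat"
begin

definition torsion_group :: "('a, 'b) monoid_scheme \<Rightarrow> bool" where
  "torsion_group G \<longleftrightarrow> group G \<and> (\<forall>x\<in>carrier G. \<exists>n::nat. n > 0 \<and> x [^]\<^bsub>G\<^esub> n = \<one>\<^bsub>G\<^esub>)"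

text \<open>On natural numbers, \<^const>\<open>Lcm\<close> of a set without nonzero common multiple is 0, and
  \<^const>\<open>group.ord\<close> is 0 on elements of infinite order. So the value 0 below means
  that no positive common multiple of the orders exists.\<close>

definition group_exponent :: "('a, 'b) monoid_scheme \<Rightarrow> enat" where
  "group_exponent G =
     (let m = Lcm (group.ord G ` carrier G) in if m = 0 then \<infinity> else enat m)"

definition unbounded_group :: "('a, 'b) monoid_scheme \<Rightarrow> bool" where
  "unbounded_group G \<longleftrightarrow> group_exponent G = \<infinity>"

lemma (in group) unbounded_group_iff:
  "unbounded_group G \<longleftrightarrow> \<not> (\<exists>n::nat. n > 0 \<and> (\<forall>x\<in>carrier G. x [^] n = \<one>))"
  by (auto simp: unbounded_group_def group_exponent_def Let_def Lcm_0_iff' pow_eq_id)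

locale topological_ab_group = comm_group G
  for G :: "('a, 'b) monoid_scheme" (structure) +
  fixes T :: "'a topology"
  assumes topspace_eq_carrier: "topspace T = carrier G"
    and continuous_mult: "continuous_map (prod_topology T T) T (\<lambda>(x, y). x \<otimes> y)"
    and continuous_inv: "continuous_map T T (\<lambda>x. inv x)"

text \<open>Completeness refers to the group uniformity, whose basic entourages are
  \<open>{(x, y). x \<otimes> inv y \<in> U}\<close> for \<open>U\<close> a neighbourhood of the identity (the left and the right
  uniformity agree because the group is Abelian).\<close>

definition group_cauchy_filter ::
    "('a, 'b) monoid_scheme \<Rightarrow> 'a topology \<Rightarrow> 'a filter \<Rightarrow> bool" where
  "group_cauchy_filter G T F \<longleftrightarrow>
     F \<noteq> bot \<and> (\<forall>\<^sub>F x in F. x \<in> carrier G) \<and>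
     (\<forall>U. openin T U \<and> \<one>\<^bsub>G\<^esub> \<in> U \<longrightarrow>
        (\<forall>\<^sub>F (x, y) in F \<times>\<^sub>F F. x \<otimes>\<^bsub>G\<^esub> inv\<^bsub>G\<^esub> y \<in> U))"

definition complete_group_topology :: "('a, 'b) monoid_scheme \<Rightarrow> 'a topology \<Rightarrow> bool" where
  "complete_group_topology G T \<longleftrightarrow>
     (\<forall>F. group_cauchy_filter G T F \<longrightarrow> (\<exists>l. limitin T (\<lambda>x. x) l F))"

definition circle_group :: "complex monoid" where
  "circle_group = \<lparr>carrier = sphere 0 1, monoid.mult = (*), one = 1\<rparr>"

lemma comm_group_circle_group: "comm_group circle_group"
proof (rule comm_groupI)
  fix x assume "x \<in> carrier circle_group"
  then have "inverse x \<in> carrier circle_group" "inverse x * x = 1"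
    by (auto simp: circle_group_def norm_inverse intro!: left_inverse)
  then show "\<exists>y\<in>carrier circle_group. y \<otimes>\<^bsub>circle_group\<^esub> x = \<one>\<^bsub>circle_group\<^esub>"
    by (auto simp: circle_group_def)
qed (auto simp: circle_group_def norm_mult)

text \<open>Only the values of a character on the carrier matter, so functions are not
  required to be extensional.\<close>

definition continuous_characters ::
    "('a, 'b) monoid_scheme \<Rightarrow> 'a topology \<Rightarrow> ('a \<Rightarrow> complex) set" where
  "continuous_characters G T =
     {h \<in> hom G circle_group. continuous_map T (top_of_set (sphere 0 1)) h}"

definition von_neumann_radical :: "('a, 'b) monoid_scheme \<Rightarrow> 'a topology \<Rightarrow> 'a set" where
  "von_neumann_radical G T = (\<Inter>h\<in>continuous_characters G T. kernel G circle_group h)"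

definition minimally_almost_periodic :: "('a, 'b) monoid_scheme \<Rightarrow> 'a topology \<Rightarrow> bool" where
  "minimally_almost_periodic G T \<longleftrightarrow> von_neumann_radical G T = carrier G"

end

theory Submission
  imports Defs
begin

text \<open>
  No metrizable topology will do: a countable complete metrizable group is discrete by Baire's
  theorem, and a discrete Abelian group has many characters. The topology is therefore the
  finest group topology in which a suitable sequence converges to the identity
  (Protasov and Zelenyuk). It has as basic neighbourhoods of the identity the sets
  \<open>\<Union>n. A (f 0) \<cdots> A (f (n - 1))\<close>, one for each \<open>f :: nat \<Rightarrow> nat\<close>, where \<open>A m\<close> is the set
  of terms from the \<open>m\<close>-th on, closed under inverses and with the identity added. For a countable group this
  topology is always complete (\<open>complete_nbhd_topology\<close>), and it is Hausdorff as soon as no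
  element \<open>x \<noteq> \<one>\<close> is, for a fixed \<open>k\<close>, a product of \<open>k\<close> elements of \<open>A m\<close> for every \<open>m\<close>
  (\<open>Hausdorff_nbhd_topology\<close>). Both rest on the fact that \<open>A m\<close> is compact: all but finitely
  many of its elements lie in any given neighbourhood of the identity.

  It remains to find a sequence that satisfies this separation condition and on which only the
  trivial character tends to 1. Let \<open>g\<close> list every element of the group infinitely often. As the
  group is torsion, finitely many elements generate a subgroup of finite exponent, and as it is
  unbounded, there is then an element of arbitrarily large order modulo that subgroup
  (\<open>exists_large_order_mod_generate\<close>). So one can choose \<open>w 0, w 1, \<dots>\<close> such that the order
  of \<open>w i\<close> modulo the earlier \<open>w\<close>'s and \<open>g 0, \<dots>, g i\<close> is huge. The sequence consists of the powers
  \<open>w i [^] j\<close> with \<open>\<bar>j\<bar> \<le> i\<^sup>2\<close> and of the elements \<open>g n \<otimes> s n\<close>, where \<open>s n\<close> is the product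
  of the \<open>w i\<close> with \<open>2 ^ n \<le> i < 2 ^ (n + 1)\<close>.

  Characters (\<open>continuous_character_trivial\<close>): if the first \<open>i\<^sup>2\<close> powers of the complex number
  \<open>h (w i)\<close> are all near 1, then \<open>h (w i)\<close> is within \<open>1 / i\<^sup>2\<close> of 1. Hence \<open>h (s n)\<close>, a
  product of \<open>2 ^ n\<close> factors that are within \<open>1 / 4 ^ n\<close> of 1, tends to 1. Since \<open>h (g n \<otimes> s n)\<close>
  tends to 1 too, so does \<open>h (g n)\<close>, and \<open>g\<close> takes every value infinitely often.

  Separation (\<open>prods_separated\<close>): in a product of \<open>k\<close> terms, a factor \<open>g n \<otimes> s n\<close> with a
  nonzero total exponent contributes that exponent to all \<open>2 ^ n\<close> elements \<open>w i\<close> of its block,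
  and at most \<open>k\<close> of these exponents can be changed by the powers \<open>w i [^] j\<close>. So,
  unless all exponents vanish and the product is \<open>\<one>\<close>, some exponent of the \<open>w i\<close> is nonzero.
  The last such \<open>w i\<close> has an exponent smaller than its order modulo everything before, so
  the product cannot be an element that \<open>g\<close> lists earlier.
\<close>

section \<open>The group topology of a family of vanishing sets\<close>

text \<open>
  \<open>A m\<close> stands for the \<open>m\<close>-th tail of a sequence that is to converge to the identity, made
  symmetric and with the identity added. \<open>finite_A_diff\<close> expresses that the tails come from a
  sequence: together with \<open>A m \<rightarrow> \<one>\<close> it makes \<open>A 0\<close> compact.
\<close>

locale vanishing_family = comm_group G
  for G :: "('a, 'b) monoid_scheme" (structure) +
  fixes A :: "nat \<Rightarrow> 'a set"
  assumes A_carrier: "A m \<subseteq> carrier G"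
    and one_in_A: "\<one> \<in> A m"
    and inv_in_A: "a \<in> A m \<Longrightarrow> inv a \<in> A m"
    and A_antimono: "m \<le> m' \<Longrightarrow> A m' \<subseteq> A m"
    and finite_A_diff: "finite (A 0 - A m)"
begin

primrec prods :: "(nat \<Rightarrow> nat) \<Rightarrow> nat \<Rightarrow> 'a set" where
  "prods f 0 = {\<one>}"
| "prods f (Suc n) = prods f n <#> A (f n)"

definition nbhd :: "(nat \<Rightarrow> nat) \<Rightarrow> 'a set" where
  "nbhd f = (\<Union>n. prods f n)"

lemma in_carrier_A: "a \<in> A m \<Longrightarrow> a \<in> carrier G"
  using A_carrier by blast

lemma in_prods_Suc: "x \<in> prods f (Suc n) \<longleftrightarrow> (\<exists>y\<in>prods f n. \<exists>a\<in>A (f n). x = y \<otimes> a)"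
  by (auto simp: set_mult_def)

lemma prods_carrier: "prods f n \<subseteq> carrier G"
  by (induction n) (auto simp del: prods.simps(2) simp: in_prods_Suc in_carrier_A subset_iff)

lemma in_carrier_prods: "x \<in> prods f n \<Longrightarrow> x \<in> carrier G"
  using prods_carrier by blast

lemma prods_1: "prods f 1 = A (f 0)"
  using in_carrier_A by (auto simp: set_mult_def)

lemma prods_Suc_superset: "prods f n \<subseteq> prods f (Suc n)"
  unfolding in_prods_Suc subset_iff using one_in_A in_carrier_prods r_one by metis

lemma prods_mono: "n \<le> m \<Longrightarrow> prods f n \<subseteq> prods f m"
  by (rule lift_Suc_mono_le[of "prods f"]) (use prods_Suc_superset in auto)

lemma prods_cong: "(\<And>i. i < n \<Longrightarrow> f i = g i) \<Longrightarrow> prods f n = prods g n"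
  by (induction n) auto

lemma prods_antimono: "(\<And>i. i < n \<Longrightarrow> f i \<le> g i) \<Longrightarrow> prods g n \<subseteq> prods f n"
proof (induction n)
  case (Suc n)
  then have "prods g n \<subseteq> prods f n" "A (g n) \<subseteq> A (f n)"
    using A_antimono by auto
  then show ?case by (auto simp: set_mult_def)
qed simp

lemma one_in_prods: "\<one> \<in> prods f n"
  using prods_mono[of 0 n f] by auto

lemma inv_in_prods: "x \<in> prods f n \<Longrightarrow> inv x \<in> prods f n"
proof (induction n arbitrary: x)
  case (Suc n)
  then obtain y a where "y \<in> prods f n" "a \<in> A (f n)" "x = y \<otimes> a"
    using in_prods_Suc by blast
  then show ?case
    using Suc.IH inv_in_A in_prods_Suc inv_mult in_carrier_A in_carrier_prods by metis
qed simp

lemma prods_add: "prods f (n + m) = prods f n <#> prods (\<lambda>i. f (n + i)) m"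
proof (induction m)
  case 0
  show ?case using in_carrier_prods by (auto simp: set_mult_def)
next
  case (Suc m)
  then show ?case
    by (simp add: set_mult_assoc prods_carrier A_carrier)
qed

text \<open>Elements of \<open>prods g n\<close> multiply by interleaving their factors, so \<open>g\<close> has to dominate the
  even and the odd part of \<open>f\<close>.\<close>

lemma prods_interleave:
  assumes "\<And>i. f (2 * i) \<le> g i" "\<And>i. f (2 * i + 1) \<le> g i"
  shows "x \<in> prods g n \<Longrightarrow> y \<in> prods g n \<Longrightarrow> x \<otimes> y \<in> prods f (2 * n)"
proof (induction n arbitrary: x y)
  case (Suc n)
  then obtain x' a y' b where x: "x' \<in> prods g n" "a \<in> A (g n)" "x = x' \<otimes> a"
    and y: "y' \<in> prods g n" "b \<in> A (g n)" "y = y' \<otimes> b"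
    using in_prods_Suc by metis
  have "a \<in> A (f (2 * n))" "b \<in> A (f (Suc (2 * n)))"
    using x y A_antimono assms[of n] by auto
  then have "((x' \<otimes> y') \<otimes> a) \<otimes> b \<in> prods f (Suc (Suc (2 * n)))"
    using Suc.IH[OF x(1) y(1)] by (auto simp: set_mult_def)
  moreover have "((x' \<otimes> y') \<otimes> a) \<otimes> b = x \<otimes> y"
    using x y by (simp add: in_carrier_A in_carrier_prods m_ac)
  ultimately show ?case by simp
qed simp

lemma nbhd_carrier: "nbhd f \<subseteq> carrier G"
  using prods_carrier by (auto simp: nbhd_def)

lemma in_carrier_nbhd: "x \<in> nbhd f \<Longrightarrow> x \<in> carrier G"
  using nbhd_carrier by blast

lemma one_in_nbhd: "\<one> \<in> nbhd f"
  using one_in_prods by (auto simp: nbhd_def)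

lemma inv_in_nbhd: "x \<in> nbhd f \<Longrightarrow> inv x \<in> nbhd f"
  using inv_in_prods by (auto simp: nbhd_def)

lemma nbhd_antimono: "(\<And>i. f i \<le> g i) \<Longrightarrow> nbhd g \<subseteq> nbhd f"
  using prods_antimono[of _ f g] by (auto simp: nbhd_def)

lemma A_subset_nbhd: "A (f 0) \<subseteq> nbhd f"
  unfolding nbhd_def prods_1[symmetric] by blast

text \<open>With its converse below, this splits a neighbourhood into a compact part, the product of
  the first \<open>n\<close> sets, and an arbitrarily small remainder. It also makes \<open>nbhd f\<close> an open set.\<close>

lemma prods_mult_nbhd_shift:
  "x \<in> prods f n \<Longrightarrow> y \<in> nbhd (\<lambda>i. f (n + i)) \<Longrightarrow> x \<otimes> y \<in> nbhd f"
proof -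
  assume "x \<in> prods f n" "y \<in> nbhd (\<lambda>i. f (n + i))"
  then obtain m where "x \<otimes> y \<in> prods f (n + m)"
    unfolding prods_add nbhd_def set_mult_def by blast
  then show ?thesis by (auto simp: nbhd_def)
qed

lemma nbhd_subset_prods_nbhd_shift: "nbhd f \<subseteq> prods f n <#> nbhd (\<lambda>i. f (n + i))"
proof
  fix x assume "x \<in> nbhd f"
  then obtain m where "x \<in> prods f m" by (auto simp: nbhd_def)
  then have "x \<in> prods f (n + m)" using prods_mono[of m "n + m" f] by auto
  then show "x \<in> prods f n <#> nbhd (\<lambda>i. f (n + i))"
    unfolding prods_add nbhd_def set_mult_def by blast
qed

lemma nbhd_half: "\<exists>g. \<forall>x\<in>nbhd g. \<forall>y\<in>nbhd g. x \<otimes> y \<in> nbhd f"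
proof (intro exI ballI)
  let ?g = "\<lambda>i. max (f (2 * i)) (f (2 * i + 1))"
  fix x y assume "x \<in> nbhd ?g" "y \<in> nbhd ?g"
  then obtain n m where "x \<in> prods ?g n" "y \<in> prods ?g m" by (auto simp: nbhd_def)
  then have "x \<in> prods ?g (max n m)" "y \<in> prods ?g (max n m)"
    using prods_mono[of n "max n m" ?g] prods_mono[of m "max n m" ?g] by auto
  then have "x \<otimes> y \<in> prods f (2 * max n m)"
    by (rule prods_interleave[rotated 2]) auto
  then show "x \<otimes> y \<in> nbhd f" by (auto simp: nbhd_def)
qed

definition nbhd_topology :: "'a topology" where
  "nbhd_topology = topology (\<lambda>U. U \<subseteq> carrier G \<and> (\<forall>x\<in>U. \<exists>f. x <# nbhd f \<subseteq> U))"

lemma openin_nbhd_topology: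
  "openin nbhd_topology U \<longleftrightarrow> U \<subseteq> carrier G \<and> (\<forall>x\<in>U. \<exists>f. x <# nbhd f \<subseteq> U)"
proof -
  have "istopology (\<lambda>U. U \<subseteq> carrier G \<and> (\<forall>x\<in>U. \<exists>f. x <# nbhd f \<subseteq> U))"
    unfolding istopology_def
  proof (intro conjI allI impI ballI)
    fix S V x
    assume S: "S \<subseteq> carrier G \<and> (\<forall>x\<in>S. \<exists>f. x <# nbhd f \<subseteq> S)"
      and V: "V \<subseteq> carrier G \<and> (\<forall>x\<in>V. \<exists>f. x <# nbhd f \<subseteq> V)" and x: "x \<in> S \<inter> V"
    then obtain f g where "x <# nbhd f \<subseteq> S" "x <# nbhd g \<subseteq> V" by blast
    moreover have "nbhd (\<lambda>i. max (f i) (g i)) \<subseteq> nbhd f \<inter> nbhd g"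
      using nbhd_antimono[of f "\<lambda>i. max (f i) (g i)"] nbhd_antimono[of g "\<lambda>i. max (f i) (g i)"]
      by auto
    ultimately have "x <# nbhd (\<lambda>i. max (f i) (g i)) \<subseteq> S \<inter> V"
      unfolding l_coset_def by blast
    then show "\<exists>f. x <# nbhd f \<subseteq> S \<inter> V" by blast
  next
    fix \<K> x
    assume "\<forall>K\<in>\<K>. K \<subseteq> carrier G \<and> (\<forall>x\<in>K. \<exists>f. x <# nbhd f \<subseteq> K)" "x \<in> \<Union> \<K>"
    then show "\<exists>f. x <# nbhd f \<subseteq> \<Union> \<K>" by (meson Union_iff Union_upper order_trans)
  qed auto
  then show ?thesis by (simp add: nbhd_topology_def)
qed

lemma topspace_nbhd_topology: "topspace nbhd_topology = carrier G"
proof -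
  have "x <# nbhd f \<subseteq> carrier G" if "x \<in> carrier G" for x f
    using that in_carrier_nbhd by (auto simp: l_coset_def)
  then have "openin nbhd_topology (carrier G)" unfolding openin_nbhd_topology by auto
  then show ?thesis
    by (metis openin_nbhd_topology openin_subset openin_topspace subset_antisym)
qed

lemma in_l_coset_nbhd: "x \<in> carrier G \<Longrightarrow> x \<in> x <# nbhd f"
  using one_in_nbhd by (force simp: l_coset_def)

lemma openin_l_coset_nbhd:
  assumes x: "x \<in> carrier G"
  shows "openin nbhd_topology (x <# nbhd f)"
  unfolding openin_nbhd_topology
proof (intro conjI ballI)
  show "x <# nbhd f \<subseteq> carrier G" using x in_carrier_nbhd by (auto simp: l_coset_def)
  fix y assume "y \<in> x <# nbhd f"
  then obtain n z where z: "z \<in> prods f n" "y = x \<otimes> z" by (auto simp: l_coset_def nbhd_def)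
  have "y <# nbhd (\<lambda>i. f (n + i)) \<subseteq> x <# nbhd f"
  proof
    fix v assume "v \<in> y <# nbhd (\<lambda>i. f (n + i))"
    then obtain t where t: "t \<in> nbhd (\<lambda>i. f (n + i))" "v = y \<otimes> t" by (auto simp: l_coset_def)
    then have "v = x \<otimes> (z \<otimes> t)"
      using z x m_assoc in_carrier_nbhd in_carrier_prods by metis
    then show "v \<in> x <# nbhd f"
      using prods_mult_nbhd_shift[OF z(1) t(1)] by (auto simp: l_coset_def)
  qed
  then show "\<exists>h. y <# nbhd h \<subseteq> x <# nbhd f" by blast
qed

lemma openin_nbhd: "openin nbhd_topology (nbhd f)"
proof -
  have "\<one> <# nbhd f = nbhd f" using in_carrier_nbhd by (auto simp: l_coset_def)
  then show ?thesis using openin_l_coset_nbhd[of "\<one>" f] by simp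
qed

lemma topological_ab_group_nbhd_topology: "topological_ab_group G nbhd_topology"
proof unfold_locales
  show "topspace nbhd_topology = carrier G" by (rule topspace_nbhd_topology)
  show "continuous_map (prod_topology nbhd_topology nbhd_topology) nbhd_topology (\<lambda>(x, y). x \<otimes> y)"
    unfolding continuous_map_def
  proof (intro conjI allI impI)
    fix U assume U: "openin nbhd_topology U"
    show "openin (prod_topology nbhd_topology nbhd_topology)
       {p \<in> topspace (prod_topology nbhd_topology nbhd_topology). (case p of (x, y) \<Rightarrow> x \<otimes> y) \<in> U}"
      unfolding openin_prod_topology_alt
    proof (intro allI impI)
      fix x y
      assume "(x, y) \<in> {p \<in> topspace (prod_topology nbhd_topology nbhd_topology).
                         (case p of (x, y) \<Rightarrow> x \<otimes> y) \<in> U}"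
      then have xy: "x \<in> carrier G" "y \<in> carrier G" "x \<otimes> y \<in> U"
        by (auto simp: topspace_nbhd_topology)
      then obtain f where f: "(x \<otimes> y) <# nbhd f \<subseteq> U"
        using U unfolding openin_nbhd_topology by blast
      obtain g where g: "\<And>s t. s \<in> nbhd g \<Longrightarrow> t \<in> nbhd g \<Longrightarrow> s \<otimes> t \<in> nbhd f"
        using nbhd_half by meson
      have "(x \<otimes> s) \<otimes> (y \<otimes> t) \<in> U" if "s \<in> nbhd g" "t \<in> nbhd g" for s t
      proof -
        have "(x \<otimes> s) \<otimes> (y \<otimes> t) = (x \<otimes> y) \<otimes> (s \<otimes> t)"
          using that xy by (simp add: in_carrier_nbhd m_ac)
        then show ?thesis using f g[OF that] by (auto simp: l_coset_def)
      qed
      then have "(x <# nbhd g) \<times> (y <# nbhd g) \<subseteq>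
          {p \<in> topspace (prod_topology nbhd_topology nbhd_topology). (case p of (x, y) \<Rightarrow> x \<otimes> y) \<in> U}"
        using xy by (auto simp: topspace_nbhd_topology l_coset_def in_carrier_nbhd)
      then show "\<exists>V W. openin nbhd_topology V \<and> openin nbhd_topology W \<and> x \<in> V \<and> y \<in> W \<and> V \<times> W \<subseteq>
          {p \<in> topspace (prod_topology nbhd_topology nbhd_topology). (case p of (x, y) \<Rightarrow> x \<otimes> y) \<in> U}"
        using openin_l_coset_nbhd in_l_coset_nbhd xy(1,2) by meson
    qed
  qed (auto simp: topspace_nbhd_topology)
  show "continuous_map nbhd_topology nbhd_topology (\<lambda>x. inv x)"
    unfolding continuous_map_def
  proof (intro conjI allI impI)
    fix U assume U: "openin nbhd_topology U"
    show "openin nbhd_topology {x \<in> topspace nbhd_topology. inv x \<in> U}"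
      unfolding openin_nbhd_topology topspace_nbhd_topology
    proof (intro conjI ballI)
      fix x assume "x \<in> {x \<in> carrier G. inv x \<in> U}"
      then have x: "x \<in> carrier G" "inv x \<in> U" by auto
      then obtain f where f: "inv x <# nbhd f \<subseteq> U" using U unfolding openin_nbhd_topology by blast
      have "inv (x \<otimes> t) \<in> U" if "t \<in> nbhd f" for t
        using f inv_in_nbhd[OF that] x that
        by (auto simp: inv_mult in_carrier_nbhd l_coset_def)
      then have "x <# nbhd f \<subseteq> {x \<in> carrier G. inv x \<in> U}"
        using x by (auto simp: l_coset_def in_carrier_nbhd)
      then show "\<exists>f. x <# nbhd f \<subseteq> {x \<in> carrier G. inv x \<in> U}" by blast
    qed auto
  qed (auto simp: topspace_nbhd_topology)
qed

text \<open>The separation hypothesis says that only \<open>\<one>\<close> is a product of \<open>k\<close> elements of \<open>A m\<close>, called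
  vanishing factors here, for every \<open>m\<close>. It extends to products of a fixed compact set
  \<open>prods f n\<close> with \<open>k\<close> vanishing factors. In the induction step, the last factor \<open>a \<in> A (f n)\<close> of the compact part either lies in
  a small \<open>A m0\<close> and joins the vanishing factors, or it is one of finitely many elements,
  each of which can be moved to the other side.\<close>

lemma not_in_prods_mult_power:
  assumes sep: "\<And>k g. g \<in> carrier G \<Longrightarrow> g \<noteq> \<one> \<Longrightarrow> \<exists>m. g \<notin> prods (\<lambda>_. m) k"
  shows "g \<in> carrier G \<Longrightarrow> g \<notin> prods f n \<Longrightarrow> \<exists>m. g \<notin> prods f n <#> prods (\<lambda>_. m) k"
proof (induction n arbitrary: g k)
  case 0
  have "{\<one>} <#> prods (\<lambda>_. m) k = prods (\<lambda>_. m) k" for m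
    using in_carrier_prods by (auto simp: set_mult_def)
  then show ?case using sep[of g k] 0 by auto
next
  case (Suc n)
  have "g \<notin> prods f n" using Suc.prems prods_Suc_superset by blast
  then obtain m0 where m0: "g \<notin> prods f n <#> prods (\<lambda>_. m0) (1 + k)"
    using Suc.IH[OF Suc.prems(1)] by blast
  have "\<exists>m. g \<otimes> inv a \<notin> prods f n <#> prods (\<lambda>_. m) k" if "a \<in> A (f n)" for a
  proof (rule Suc.IH)
    show "g \<otimes> inv a \<in> carrier G" using that Suc.prems in_carrier_A by blast
    show "g \<otimes> inv a \<notin> prods f n"
    proof
      assume "g \<otimes> inv a \<in> prods f n"
      then have "(g \<otimes> inv a) \<otimes> a \<in> prods f (Suc n)" using that unfolding in_prods_Suc by blast
      then show False using Suc.prems that in_carrier_A by (metis inv_closed inv_solve_right m_closed)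
    qed
  qed
  then obtain M where M: "\<And>a. a \<in> A (f n) \<Longrightarrow> g \<otimes> inv a \<notin> prods f n <#> prods (\<lambda>_. M a) k"
    by metis
  have fin: "finite (A (f n) - A m0)"
    by (rule finite_subset[OF _ finite_A_diff[of m0]]) (use A_antimono[of 0 "f n"] in auto)
  define m where "m = Max (insert m0 (M ` (A (f n) - A m0)))"
  have m: "m0 \<le> m" "\<And>a. a \<in> A (f n) - A m0 \<Longrightarrow> M a \<le> m"
    using fin by (auto simp: m_def)
  have "g \<notin> prods f (Suc n) <#> prods (\<lambda>_. m) k"
  proof
    assume "g \<in> prods f (Suc n) <#> prods (\<lambda>_. m) k"
    then obtain y a z where y: "y \<in> prods f n" and a: "a \<in> A (f n)" and z: "z \<in> prods (\<lambda>_. m) k"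
      and g: "g = (y \<otimes> a) \<otimes> z" unfolding set_mult_def[of _ "prods (\<lambda>_. m) k"] by (auto simp: set_mult_def)
    have car: "y \<in> carrier G" "a \<in> carrier G" "z \<in> carrier G"
      using y a z in_carrier_A in_carrier_prods by auto
    show False
    proof (cases "a \<in> A m0")
      case True
      have "z \<in> prods (\<lambda>_. m0) k" using prods_antimono[of k "\<lambda>_. m0" "\<lambda>_. m"] m z by auto
      moreover have "a \<in> prods (\<lambda>_. m0) 1" using True by (simp only: prods_1)
      ultimately have "a \<otimes> z \<in> prods (\<lambda>_. m0) (1 + k)"
        unfolding prods_add unfolding set_mult_def by blast
      moreover have "g = y \<otimes> (a \<otimes> z)" using g car m_assoc by simp
      ultimately show False using m0 y unfolding set_mult_def by blast
    next
      case False
      then have "z \<in> prods (\<lambda>_. M a) k"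
        using prods_antimono[of k "\<lambda>_. M a" "\<lambda>_. m"] m(2)[of a] z a by auto
      moreover have "g \<otimes> inv a = y \<otimes> z"
      proof -
        have "g = (y \<otimes> z) \<otimes> a" using car g by (simp add: m_ac)
        then show ?thesis using car by (simp add: m_assoc)
      qed
      ultimately show False using M[OF a] y by (auto simp: set_mult_def)
    qed
  qed
  then show ?case by blast
qed

text \<open>To avoid \<open>g\<close>, the values \<open>f 0, f 1, \<dots>\<close> are chosen one by one, each so large that
  \<open>g\<close> still lies outside the products formed so far.\<close>

lemma Hausdorff_nbhd_topology:
  assumes sep: "\<And>k g. g \<in> carrier G \<Longrightarrow> g \<noteq> \<one> \<Longrightarrow> \<exists>m. g \<notin> prods (\<lambda>_. m) k"
  shows "Hausdorff_space nbhd_topology"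
proof -
  have avoid: "\<exists>f. g \<notin> nbhd f" if g: "g \<in> carrier G" "g \<noteq> \<one>" for g
  proof -
    have "\<exists>f. \<forall>n. g \<notin> prods f n \<longrightarrow> g \<notin> prods f n <#> A (f n)"
    proof (rule dependent_wellorder_choice)
      fix r :: nat and f f' :: "nat \<Rightarrow> nat" and n
      assume "\<And>i. i < n \<Longrightarrow> f i = f' i"
      then have "prods f n = prods f' n" by (rule prods_cong)
      then show "(g \<notin> prods f n \<longrightarrow> g \<notin> prods f n <#> A r) = (g \<notin> prods f' n \<longrightarrow> g \<notin> prods f' n <#> A r)"
        by simp
    next
      fix n and f :: "nat \<Rightarrow> nat"
      show "\<exists>r. g \<notin> prods f n \<longrightarrow> g \<notin> prods f n <#> A r"
        using not_in_prods_mult_power[OF sep g(1), of f n 1] unfolding prods_1 by blast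
    qed
    then obtain f where f: "\<And>n. g \<notin> prods f n \<Longrightarrow> g \<notin> prods f n <#> A (f n)" by blast
    have "g \<notin> prods f n" for n by (induction n) (use g f in auto)
    then show ?thesis by (auto simp: nbhd_def)
  qed
  show ?thesis
    unfolding Hausdorff_space_def topspace_nbhd_topology
  proof (intro allI impI)
    fix x y assume "x \<in> carrier G \<and> y \<in> carrier G \<and> x \<noteq> y"
    then have xy: "x \<in> carrier G" "y \<in> carrier G" "x \<noteq> y" by auto
    then have "inv x \<otimes> y \<noteq> \<one>" by (metis inv_closed inv_equality inv_inv)
    then obtain f where f: "inv x \<otimes> y \<notin> nbhd f" using avoid[of "inv x \<otimes> y"] xy by blast
    obtain g where g: "\<And>s t. s \<in> nbhd g \<Longrightarrow> t \<in> nbhd g \<Longrightarrow> s \<otimes> t \<in> nbhd f"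
      using nbhd_half by meson
    have "(x <# nbhd g) \<inter> (y <# nbhd g) = {}"
    proof (rule ccontr)
      assume "(x <# nbhd g) \<inter> (y <# nbhd g) \<noteq> {}"
      then obtain s t where st: "s \<in> nbhd g" "t \<in> nbhd g" "x \<otimes> s = y \<otimes> t"
        by (auto simp: l_coset_def)
      have "s \<in> carrier G" "t \<in> carrier G" using st in_carrier_nbhd by auto
      then have "inv x \<otimes> y = s \<otimes> inv t"
        using st(3) xy by (metis inv_closed inv_solve_left inv_solve_right m_assoc m_closed)
      then show False using f g[OF st(1) inv_in_nbhd[OF st(2)]] by simp
    qed
    then show "\<exists>U V. openin nbhd_topology U \<and> openin nbhd_topology V \<and> x \<in> U \<and> y \<in> V \<and> disjnt U V"
      unfolding disjnt_def using openin_l_coset_nbhd in_l_coset_nbhd xy by meson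
  qed
qed

text \<open>Suppose that a Cauchy filter has no limit. Then every element, and by compactness every
  translate of a set \<open>prods f n\<close>, has a neighbourhood that the filter eventually avoids. Let
  \<open>e 0, e 1, \<dots>\<close> list the group, and choose \<open>f\<close> by recursion such that, for each \<open>n\<close>, the
  remainder of \<open>nbhd f\<close> after the first \<open>n\<close> factors is small enough for the compact set
  \<open>e n <# prods f n\<close>. Then the filter eventually avoids every translate of \<open>nbhd f\<close>, whereas a
  Cauchy filter contains a set that lies in a single one.\<close>

lemma complete_nbhd_topology:
  assumes count: "countable (carrier G)"
  shows "complete_group_topology G nbhd_topology"
  unfolding complete_group_topology_def
proof (intro allI impI, rule ccontr)
  fix F assume F: "group_cauchy_filter G nbhd_topology F" 
    and nolim: "\<nexists>l. limitin nbhd_topology (\<lambda>x. x) l F"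
  have F_ne: "F \<noteq> bot" and F_car: "\<forall>\<^sub>F x in F. x \<in> carrier G"
    using F by (auto simp: group_cauchy_filter_def)
  have cauchy: "\<exists>P Q. eventually P F \<and> eventually Q F \<and> (\<forall>x y. P x \<longrightarrow> Q y \<longrightarrow> x \<otimes> inv y \<in> nbhd f)" for f
    using F openin_nbhd[of f] one_in_nbhd[of f]
    by (auto simp: group_cauchy_filter_def eventually_prod_filter)
  \<comment> \<open>A cluster point of a Cauchy filter is a limit of it, so \<open>g\<close> is not even a cluster point.\<close>
  have avoid_point: "\<exists>h. \<forall>\<^sub>F x in F. x \<notin> g <# nbhd h" if g: "g \<in> carrier G" for g
  proof -
    obtain U where "openin nbhd_topology U" "g \<in> U" and nU: "\<not> (\<forall>\<^sub>F x in F. x \<in> U)"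
      using nolim g by (auto simp: limitin_def topspace_nbhd_topology)
    then obtain f where f: "g <# nbhd f \<subseteq> U" by (auto simp: openin_nbhd_topology)
    obtain h where h: "\<And>s t. s \<in> nbhd h \<Longrightarrow> t \<in> nbhd h \<Longrightarrow> s \<otimes> t \<in> nbhd f"
      using nbhd_half by meson
    obtain P Q where PQ: "eventually P F" "eventually Q F" "\<And>x y. P x \<Longrightarrow> Q y \<Longrightarrow> x \<otimes> inv y \<in> nbhd h"
      using cauchy by metis
    have "\<forall>\<^sub>F x in F. x \<notin> g <# nbhd h"
    proof (rule ccontr)
      assume "\<not> (\<forall>\<^sub>F x in F. x \<notin> g <# nbhd h)"
      then have "\<not> (\<forall>y. Q y \<longrightarrow> y \<notin> g <# nbhd h)"
        using eventually_mono[OF PQ(2), of "\<lambda>x. x \<notin> g <# nbhd h"] by blast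
      then obtain y where y: "Q y" "y \<in> g <# nbhd h" by blast
      then obtain t where t: "t \<in> nbhd h" "y = g \<otimes> t" by (auto simp: l_coset_def)
      have "\<forall>\<^sub>F x in F. x \<in> U" using PQ(1) F_car
      proof eventually_elim
        case (elim x)
        have tc: "t \<in> carrier G" using t in_carrier_nbhd by auto
        have "x \<otimes> inv y \<in> nbhd h" using PQ(3) elim y by blast
        then have "(x \<otimes> inv y) \<otimes> t \<in> nbhd f" using h t by blast
        moreover have "x = g \<otimes> ((x \<otimes> inv y) \<otimes> t)"
        proof -
          have yc: "y \<in> carrier G" using t(2) tc g by simp
          have "g \<otimes> ((x \<otimes> inv y) \<otimes> t) = (x \<otimes> inv y) \<otimes> y"
            unfolding t(2) using tc g elim yc t(2) by (intro m_lcomm) auto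
          also have "\<dots> = x" using yc elim by (simp add: m_assoc)
          finally show ?thesis by simp
        qed
        ultimately show ?case using f by (auto simp: l_coset_def)
      qed
      then show False using nU by blast
    qed
    then show ?thesis by blast
  qed
  \<comment> \<open>Compactness of \<open>prods f n\<close>, one factor at a time: a factor from \<open>A (h' 0)\<close> is absorbed
      into the neighbourhood, and the finitely many others are treated separately.\<close>
  have avoid: "\<exists>h. \<forall>\<^sub>F x in F. x \<notin> g <# (prods f n <#> nbhd h)" if g: "g \<in> carrier G" for g f n
    using g
  proof (induction n arbitrary: g)
    case 0
    have "{\<one>} <#> nbhd h = nbhd h" for h using in_carrier_nbhd by (auto simp: set_mult_def)
    then show ?case using avoid_point[OF 0] by simp
  next
    case (Suc n)
    obtain h where h: "\<forall>\<^sub>F x in F. x \<notin> g <# (prods f n <#> nbhd h)" using Suc by blast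
    obtain h' where h': "\<And>s t. s \<in> nbhd h' \<Longrightarrow> t \<in> nbhd h' \<Longrightarrow> s \<otimes> t \<in> nbhd h"
      using nbhd_half by meson
    have "\<exists>e. \<forall>\<^sub>F x in F. x \<notin> (g \<otimes> a) <# (prods f n <#> nbhd e)" if "a \<in> A (f n)" for a
      using Suc that in_carrier_A by blast
    then obtain E where E: "\<And>a. a \<in> A (f n) \<Longrightarrow> \<forall>\<^sub>F x in F. x \<notin> (g \<otimes> a) <# (prods f n <#> nbhd (E a))"
      by metis
    let ?D = "A (f n) - A (h' 0)"
    have fin: "finite ?D"
      by (rule finite_subset[OF _ finite_A_diff[of "h' 0"]]) (use A_antimono[of 0 "f n"] in auto)
    define e where "e i = Max (insert (h' i) ((\<lambda>a. E a i) ` ?D))" for i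
    have e: "h' i \<le> e i" "\<And>a. a \<in> ?D \<Longrightarrow> E a i \<le> e i" for i
      using fin by (auto simp: e_def)
    have "\<forall>\<^sub>F x in F. \<forall>a\<in>?D. x \<notin> (g \<otimes> a) <# (prods f n <#> nbhd (E a))"
      using fin E by (auto simp: eventually_ball_finite)
    with h have "\<forall>\<^sub>F x in F. x \<notin> g <# (prods f (Suc n) <#> nbhd e)"
    proof eventually_elim
      case (elim x)
      show ?case
      proof
        assume "x \<in> g <# (prods f (Suc n) <#> nbhd e)"
        then obtain y a z where y: "y \<in> prods f n" and a: "a \<in> A (f n)" and z: "z \<in> nbhd e"
          and x: "x = g \<otimes> ((y \<otimes> a) \<otimes> z)"
          by (auto simp: l_coset_def set_mult_def)
        have car: "y \<in> carrier G" "a \<in> carrier G" "z \<in> carrier G"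
          using y a z in_carrier_A in_carrier_prods in_carrier_nbhd by auto
        show False
        proof (cases "a \<in> A (h' 0)")
          case True
          have "a \<in> nbhd h'" using True A_subset_nbhd by blast
          moreover have "z \<in> nbhd h'" using nbhd_antimono[of h' e] e z by auto
          ultimately have "a \<otimes> z \<in> nbhd h" by (rule h')
          moreover have "x = g \<otimes> (y \<otimes> (a \<otimes> z))" using x car m_assoc by simp
          ultimately show False using elim(1) y by (auto simp: l_coset_def set_mult_def)
        next
          case False
          then have "z \<in> nbhd (E a)" using nbhd_antimono[of "E a" e] e(2)[of a] z a by auto
          moreover have "x = (g \<otimes> a) \<otimes> (y \<otimes> z)" using x car Suc.prems by (simp add: m_ac)
          ultimately show False using elim(2) False a y by (auto simp: l_coset_def set_mult_def)
        qed
      qed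
    qed
    then show ?case by blast
  qed
  define e where "e = from_nat_into (carrier G)"
  have e: "e n \<in> carrier G" for n unfolding e_def by (rule from_nat_into) auto
  have e_surj: "\<exists>n. e n = g" if "g \<in> carrier G" for g
    using from_nat_into_surj[OF count that] unfolding e_def by blast
  have "\<exists>h. (\<exists>f. S = prods f n) \<longrightarrow> (\<forall>\<^sub>F x in F. x \<notin> e n <# (S <#> nbhd h))" for S n
    using avoid[OF e] by blast
  then obtain K where K: "\<And>n f. \<forall>\<^sub>F x in F. x \<notin> e n <# (prods f n <#> nbhd (K (prods f n) n))"
    by metis
  \<comment> \<open>The value \<open>f m\<close> answers the demands made at all stages \<open>n \<le> m\<close>; the demand of stage \<open>n\<close>
      depends only on the values of \<open>f\<close> below \<open>n\<close>, so the recursion is well-founded.\<close>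
  have "\<exists>f. \<forall>m. \<forall>n\<le>m. K (prods f n) n (m - n) \<le> f m"
  proof (rule dependent_wellorder_choice)
    fix r :: nat and f f' :: "nat \<Rightarrow> nat" and m
    assume "\<And>i. i < m \<Longrightarrow> f i = f' i"
    then have "\<forall>n\<le>m. prods f n = prods f' n" by (auto intro!: prods_cong)
    then show "(\<forall>n\<le>m. K (prods f n) n (m - n) \<le> r) = (\<forall>n\<le>m. K (prods f' n) n (m - n) \<le> r)"
      by simp
  next
    fix m and f :: "nat \<Rightarrow> nat"
    show "\<exists>r. \<forall>n\<le>m. K (prods f n) n (m - n) \<le> r"
      by (rule exI[of _ "Max ((\<lambda>n. K (prods f n) n (m - n)) ` {..m})"]) auto
  qed
  then obtain f where f: "\<And>m n. n \<le> m \<Longrightarrow> K (prods f n) n (m - n) \<le> f m" by blast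
  have away: "\<forall>\<^sub>F x in F. x \<notin> e n <# nbhd f" for n
  proof -
    have "nbhd (\<lambda>i. f (n + i)) \<subseteq> nbhd (K (prods f n) n)"
      by (rule nbhd_antimono) (use f[of n "n + _"] in auto)
    then have "nbhd f \<subseteq> prods f n <#> nbhd (K (prods f n) n)"
      using nbhd_subset_prods_nbhd_shift[of f n] mono_set_mult[OF subset_refl] by fast
    then have "e n <# nbhd f \<subseteq> e n <# (prods f n <#> nbhd (K (prods f n) n))"
      unfolding l_coset_def by blast
    then show ?thesis by (intro eventually_mono[OF K[of n f]]) auto
  qed
  obtain P Q where PQ: "eventually P F" "eventually Q F" "\<And>x y. P x \<Longrightarrow> Q y \<Longrightarrow> x \<otimes> inv y \<in> nbhd f"
    using cauchy by metis
  obtain y where y: "Q y" "y \<in> carrier G"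
    using eventually_happens'[OF F_ne eventually_conj[OF PQ(2) F_car]] by blast
  obtain n where n: "e n = y" using e_surj y by blast
  have "\<forall>\<^sub>F x in F. False" using away[of n] PQ(1) F_car
  proof eventually_elim
    case (elim x)
    have "x \<otimes> inv y \<in> nbhd f" using PQ(3) elim y by blast
    moreover have "x = y \<otimes> (x \<otimes> inv y)"
      using elim(3) y(2) by (simp add: m_lcomm)
    ultimately show False using elim(1) n by (auto simp: l_coset_def)
  qed
  then show False using F_ne by simp
qed

end

section \<open>Elements of large order modulo a finitely generated subgroup\<close>

lemma (in comm_group) subgroup_finprod_closed:
  assumes H: "subgroup H G" and f: "\<And>i. i \<in> I \<Longrightarrow> f i \<in> H"
  shows "finprod G f I \<in> H"
  using f
proof (induction I rule: infinite_finite_induct)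
  case (insert i I)
  have "f \<in> insert i I \<rightarrow> carrier G" using insert.prems subgroup.mem_carrier[OF H] by blast
  then show ?case using insert by (simp add: subgroup.m_closed[OF H])
qed (auto simp: subgroup.one_closed[OF H])

text \<open>The generators have a common exponent \<open>N\<close>, which is then an exponent of the subgroup that
  they generate. If every element had a power with positive exponent at most \<open>B\<close> in that subgroup, then
  \<open>fact B * N\<close> would be an exponent of the whole group.\<close>

lemma (in comm_group) exists_large_order_mod_generate:
  assumes torsion: "\<And>x. x \<in> carrier G \<Longrightarrow> \<exists>n::nat. n > 0 \<and> x [^] n = \<one>"
    and unbounded: "\<not> (\<exists>n::nat. n > 0 \<and> (\<forall>x\<in>carrier G. x [^] n = \<one>))"
    and X: "finite X" "X \<subseteq> carrier G"
  shows "\<exists>w\<in>carrier G. \<forall>j::nat. 0 < j \<and> j \<le> B \<longrightarrow> w [^] j \<notin> generate G X"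
proof (rule ccontr)
  assume neg: "\<not> ?thesis"
  obtain ordr :: "'a \<Rightarrow> nat" where ordr: "\<And>x. x \<in> carrier G \<Longrightarrow> ordr x > 0 \<and> x [^] ordr x = \<one>"
    using torsion by metis
  define N where "N = (\<Prod>x\<in>X. ordr x)"
  have N: "N > 0" using ordr X by (auto simp: N_def intro!: prod_pos)
  have pow_mult_eq_one: "x [^] (a * b) = \<one>" if "x \<in> carrier G" "x [^] a = \<one>" for x and a b :: nat
    using that by (metis nat_pow_one nat_pow_pow)
  have sub: "subgroup {y \<in> carrier G. y [^] N = \<one>} G"
    by (rule subgroupI) (auto simp: nat_pow_inv nat_pow_distrib)
  have "x [^] N = \<one>" if "x \<in> X" for x
  proof -
    have "ordr x dvd N" unfolding N_def using X that by (simp add: dvd_prodI)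
    then show ?thesis using pow_mult_eq_one ordr that X by (metis dvdE subsetD)
  qed
  then have gen: "generate G X \<subseteq> {y \<in> carrier G. y [^] N = \<one>}"
    by (intro generate_subgroup_incl[OF _ sub]) (use X in auto)
  have "w [^] (fact B * N) = \<one>" if w: "w \<in> carrier G" for w
  proof -
    obtain j :: nat where j: "0 < j" "j \<le> B" "w [^] j \<in> generate G X" using neg w by blast
    have "w [^] (j * N) = \<one>" using gen j(3) w by (auto simp: nat_pow_pow)
    moreover obtain c where "(fact B :: nat) = j * c" using dvd_fact[of j B] j by (auto elim: dvdE)
    ultimately show ?thesis using pow_mult_eq_one[OF w, of "j * N" c] by (simp add: mult_ac)
  qed
  then show False using unbounded N by (metis fact_gt_zero nat_0_less_mult_iff)
qed

lemma (in comm_group) exists_sequence_large_orders: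
  fixes g :: "nat \<Rightarrow> 'a" and B :: "nat \<Rightarrow> nat"
  assumes torsion: "\<And>x. x \<in> carrier G \<Longrightarrow> \<exists>n::nat. n > 0 \<and> x [^] n = \<one>"
    and unbounded: "\<not> (\<exists>n::nat. n > 0 \<and> (\<forall>x\<in>carrier G. x [^] n = \<one>))"
    and g: "\<And>n. g n \<in> carrier G"
  shows "\<exists>w. \<forall>i. w i \<in> carrier G \<and>
           (\<forall>j::nat. 0 < j \<and> j \<le> B i \<longrightarrow> w i [^] j \<notin> generate G (w ` {..<i} \<union> g ` {..i}))"
proof (rule dependent_wellorder_choice)
  fix r and f f' :: "nat \<Rightarrow> 'a" and i
  assume "\<And>l. l < i \<Longrightarrow> f l = f' l"
  then have "f ` {..<i} = f' ` {..<i}" by auto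
  then show "(r \<in> carrier G \<and> (\<forall>j::nat. 0 < j \<and> j \<le> B i \<longrightarrow> r [^] j \<notin> generate G (f ` {..<i} \<union> g ` {..i})))
      = (r \<in> carrier G \<and> (\<forall>j::nat. 0 < j \<and> j \<le> B i \<longrightarrow> r [^] j \<notin> generate G (f' ` {..<i} \<union> g ` {..i})))"
    by simp
next
  fix i and f :: "nat \<Rightarrow> 'a"
  assume "\<And>l. l < i \<Longrightarrow> f l \<in> carrier G \<and>
    (\<forall>j::nat. 0 < j \<and> j \<le> B l \<longrightarrow> f l [^] j \<notin> generate G (f ` {..<l} \<union> g ` {..l}))"
  then have "f ` {..<i} \<union> g ` {..i} \<subseteq> carrier G" using g by auto
  from exists_large_order_mod_generate[OF torsion unbounded _ this, of "B i"]
  show "\<exists>r. r \<in> carrier G \<and> (\<forall>j::nat. 0 < j \<and> j \<le> B i \<longrightarrow> r [^] j \<notin> generate G (f ` {..<i} \<union> g ` {..i}))"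
    by auto
qed

section \<open>A sequence that no nontrivial character sends to 1\<close>

text \<open>The powers below \<open>K\<close> have real part at least 1/2, so \<open>\<bar>\<Sum>j<K. z ^ j\<bar> \<ge> K / 2\<close>, and this
  sum times \<open>z - 1\<close> is \<open>z ^ K - 1\<close>.\<close>

lemma norm_diff_one_le_of_powers:
  fixes z :: complex
  assumes K: "K > 0" and pow: "\<And>j. j \<le> K \<Longrightarrow> norm (z ^ j - 1) \<le> 1 / 2"
  shows "norm (z - 1) \<le> 1 / real K"
proof -
  have "real K / 2 = (\<Sum>j<K. 1 / 2)" by simp
  also have "\<dots> \<le> (\<Sum>j<K. Re (z ^ j))"
  proof (rule sum_mono)
    fix j assume "j \<in> {..<K}"
    then have "\<bar>Re (z ^ j - 1)\<bar> \<le> 1 / 2" using pow[of j] abs_Re_le_cmod[of "z ^ j - 1"] by simp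
    then have "\<bar>Re (z ^ j) - 1\<bar> \<le> 1 / 2" by simp
    then show "1 / 2 \<le> Re (z ^ j)" unfolding abs_le_iff by linarith
  qed
  also have "\<dots> \<le> norm (\<Sum>j<K. z ^ j)" using complex_Re_le_cmod[of "\<Sum>j<K. z ^ j"] by simp
  finally have "norm (z - 1) * (real K / 2) \<le> norm (z - 1) * norm (\<Sum>j<K. z ^ j)"
    by (rule mult_left_mono) simp
  also have "\<dots> = norm (z ^ K - 1)" by (simp add: power_diff_1_eq norm_mult)
  also have "\<dots> \<le> 1 / 2" using pow by simp
  finally show ?thesis using K by (simp add: field_simps)
qed

text \<open>The bound \<open>i * (i * i + 1)\<close> on the order covers every exponent of \<open>w i\<close> that can occur in a
  product of \<open>k \<le> i\<close> factors: each factor contributes at most \<open>i * i\<close> as a power of \<open>w i\<close>, or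
  1 as part of a block.\<close>

locale sparse_sequence = comm_group G
  for G :: "('a, 'b) monoid_scheme" (structure) +
  fixes g w :: "nat \<Rightarrow> 'a"
  assumes g_carrier: "g n \<in> carrier G"
    and w_carrier: "w i \<in> carrier G"
    and g_recurrent: "x \<in> carrier G \<Longrightarrow> \<exists>n\<ge>m. g n = x"
    and w_independent: "0 < j \<Longrightarrow> j \<le> i * (i * i + 1) \<Longrightarrow>
          w i [^] (j::nat) \<notin> generate G (w ` {..<i} \<union> g ` {..i})"
begin

definition block :: "nat \<Rightarrow> nat set" where
  "block n = {2 ^ n..<2 ^ Suc n}"

definition s :: "nat \<Rightarrow> 'a" where
  "s n = finprod G w (block n)"

inductive_set A :: "nat \<Rightarrow> 'a set" for m :: nat where
  w_power: "m \<le> i \<Longrightarrow> \<bar>j\<bar> \<le> int (i * i) \<Longrightarrow> w i [^] (j::int) \<in> A m"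
| g_s: "m \<le> n \<Longrightarrow> g n \<otimes> s n \<in> A m"
| inv_g_s: "m \<le> n \<Longrightarrow> inv (g n \<otimes> s n) \<in> A m"

lemma finite_block: "finite (block n)" and card_block: "card (block n) = 2 ^ n"
  by (auto simp: block_def)

lemma less_of_block: "i \<in> block n \<Longrightarrow> n < i"
  by (auto simp: block_def intro: less_le_trans[OF less_exp])

lemma block_disjoint: "i \<in> block n \<Longrightarrow> i \<in> block n' \<Longrightarrow> n = n'"
proof (induction n n' rule: linorder_wlog)
  case (le n n')
  then have "(2::nat) ^ n' < 2 ^ Suc n" by (auto simp: block_def)
  then have "n' < Suc n" by (simp only: power_strict_increasing_iff)
  then show ?case using le by simp
qed auto

lemma s_carrier: "s n \<in> carrier G"
  unfolding s_def using w_carrier by auto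

lemmas carriers = g_carrier w_carrier s_carrier

sublocale vanishing_family G A
proof
  fix m :: nat
  show "A m \<subseteq> carrier G" by (auto simp: carriers elim: A.cases)
  show "\<one> \<in> A m" using A.w_power[of m m 0] by simp
  show "inv a \<in> A m" if "a \<in> A m" for a
    using that
  proof cases
    case (w_power i j)
    then have "inv a = w i [^] (- j)" by (simp add: int_pow_neg carriers)
    then show ?thesis using A.w_power[of m i "- j"] w_power by simp
  next
    case (inv_g_s n)
    then show ?thesis using A.g_s[of m n] by (simp add: carriers)
  qed (auto intro: A.inv_g_s)
  show "A m' \<subseteq> A m" if "m \<le> m'" for m'
  proof
    fix a assume "a \<in> A m'"
    then show "a \<in> A m" by cases (use that in \<open>auto intro: A.intros\<close>)
  qed
  have "A 0 - A m \<subseteq> (\<Union>i<m. (\<lambda>j::int. w i [^] j) ` {- int (i * i)..int (i * i)})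
      \<union> (\<lambda>n. g n \<otimes> s n) ` {..<m} \<union> (\<lambda>n. inv (g n \<otimes> s n)) ` {..<m}"
    (is "_ \<subseteq> ?U")
  proof
    fix a assume "a \<in> A 0 - A m"
    then have a: "a \<in> A 0" "a \<notin> A m" by auto
    from a(1) show "a \<in> ?U"
    proof cases
      case (w_power i j)
      then have "i < m" using a(2) A.w_power[of m i j] not_le by blast
      moreover have "j \<in> {- int (i * i)..int (i * i)}" using w_power by (simp add: abs_le_iff)
      ultimately show ?thesis using w_power(1) by blast
    next
      case (g_s n)
      then have "n < m" using a(2) A.g_s[of m n] not_le by blast
      then show ?thesis using g_s by blast
    next
      case (inv_g_s n)
      then have "n < m" using a(2) A.inv_g_s[of m n] not_le by blast
      then show ?thesis using inv_g_s by blast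
    qed
  qed
  then show "finite (A 0 - A m)" by (rule finite_subset) auto
qed

definition word :: "nat \<Rightarrow> (nat \<Rightarrow> int) \<Rightarrow> (nat \<Rightarrow> int) \<Rightarrow> 'a" where
  "word N d c = (\<Otimes>i\<in>{..<N}. w i [^] d i) \<otimes> (\<Otimes>i\<in>{..<N}. g i [^] c i)"

lemma word_mult: "word N (\<lambda>i. d i + d' i) (\<lambda>i. c i + c' i) = word N d c \<otimes> word N d' c'"
  by (simp add: word_def int_pow_mult carriers Pi_def m_ac)

lemma word_zero: "word N (\<lambda>_. 0) (\<lambda>_. 0) = \<one>"
  by (simp add: word_def)

lemma word_carrier: "word N d c \<in> carrier G"
  by (simp add: word_def carriers Pi_def)

lemma word_uminus: "word N (\<lambda>i. - d i) (\<lambda>i. - c i) = inv (word N d c)"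
proof -
  have "word N (\<lambda>i. - d i) (\<lambda>i. - c i) \<otimes> word N d c = \<one>"
    unfolding word_mult[symmetric] by (simp add: word_zero)
  then show ?thesis using inv_equality word_carrier by metis
qed

text \<open>What is known about the exponents when \<open>x\<close> is a product of \<open>k\<close> elements of \<open>A m\<close>. A
  factor \<open>g n \<otimes> s n\<close> or its inverse changes \<open>c n\<close> and all \<open>d i\<close> with \<open>i \<in> block n\<close> by the same
  amount; only the factors that are powers of a single \<open>w i\<close> break the equality \<open>d i = c n\<close>, and
  \<open>E\<close> collects their indices.\<close>

definition expansion ::
    "nat \<Rightarrow> nat \<Rightarrow> 'a \<Rightarrow> (nat \<Rightarrow> int) \<Rightarrow> (nat \<Rightarrow> int) \<Rightarrow> nat set \<Rightarrow> bool" where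
  "expansion k m x d c E \<longleftrightarrow>
     (\<forall>\<^sub>F N in sequentially. x = word N d c \<and> d N = 0 \<and> c N = 0) \<and>
     (\<forall>i. \<bar>d i\<bar> \<le> int (k * (i * i + 1))) \<and>
     (\<forall>i<m. d i = 0 \<and> c i = 0) \<and>
     finite E \<and> card E \<le> k \<and> (\<forall>n. \<forall>i\<in>block n - E. d i = c n)"

lemma expansion_one: "expansion 0 m \<one> (\<lambda>_. 0) (\<lambda>_. 0) {}"
  by (simp add: expansion_def word_zero)

lemma expansion_mult:
  assumes "expansion k m x d c E" "expansion l m y d' c' E'"
  shows "expansion (k + l) m (x \<otimes> y) (\<lambda>i. d i + d' i) (\<lambda>i. c i + c' i) (E \<union> E')"
  unfolding expansion_def
proof (intro conjI allI ballI impI)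
  show "\<forall>\<^sub>F N in sequentially. x \<otimes> y = word N (\<lambda>i. d i + d' i) (\<lambda>i. c i + c' i)
      \<and> d N + d' N = 0 \<and> c N + c' N = 0"
    using assms unfolding expansion_def by (auto simp: word_mult elim: eventually_elim2)
  show "\<bar>d i + d' i\<bar> \<le> int ((k + l) * (i * i + 1))" for i
  proof -
    have "\<bar>d i\<bar> \<le> int (k * (i * i + 1))" "\<bar>d' i\<bar> \<le> int (l * (i * i + 1))"
      using assms by (auto simp: expansion_def)
    then show ?thesis unfolding distrib_right[of k l] of_nat_add by linarith
  qed
  show "card (E \<union> E') \<le> k + l"
    using card_Un_le[of E E'] assms by (auto simp: expansion_def)
qed (use assms in \<open>auto simp: expansion_def\<close>)

lemma expansion_inv:
  assumes "expansion k m x d c E"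
  shows "expansion k m (inv x) (\<lambda>i. - d i) (\<lambda>i. - c i) E"
  using assms unfolding expansion_def by (auto simp: word_uminus elim: eventually_mono)

lemma finprod_indicator_pow:
  fixes f :: "nat \<Rightarrow> 'a"
  assumes "\<And>i. f i \<in> carrier G" "finite I" "I \<subseteq> {..<N}" 
  shows "(\<Otimes>i\<in>{..<N}. f i [^] (if i \<in> I then j i else (0::int))) = (\<Otimes>i\<in>I. f i [^] j i)"
  using assms by (intro finprod_mono_neutral_cong_right) auto

lemma expansion_w_power:
  assumes "m \<le> i" "\<bar>j\<bar> \<le> int (i * i)"
  shows "expansion 1 m (w i [^] j) (\<lambda>l. if l \<in> {i} then j else 0) (\<lambda>_. 0) {i}"
  unfolding expansion_def
proof (intro conjI)
  show "\<forall>\<^sub>F N in sequentially. w i [^] j = word N (\<lambda>l. if l \<in> {i} then j else 0) (\<lambda>_. 0)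
      \<and> (if N \<in> {i} then j else 0) = 0 \<and> (0::int) = 0"
    using eventually_gt_at_top[of i]
  proof eventually_elim
    case (elim N)
    then show ?case
      using finprod_indicator_pow[of w "{i}" N "\<lambda>_. j"] by (simp add: word_def carriers)
  qed
qed (use assms in \<open>auto simp: expansion_def\<close>)

lemma expansion_g_s:
  assumes "m \<le> n"
  shows "expansion 1 m (g n \<otimes> s n) (\<lambda>i. if i \<in> block n then 1 else 0) (\<lambda>l. if l \<in> {n} then 1 else 0) {}"
  unfolding expansion_def
proof (intro conjI)
  show "\<forall>\<^sub>F N in sequentially.
      g n \<otimes> s n = word N (\<lambda>i. if i \<in> block n then 1 else 0) (\<lambda>l. if l \<in> {n} then 1 else 0)
      \<and> (if N \<in> block n then 1 else 0 :: int) = 0 \<and> (if N \<in> {n} then 1 else 0 :: int) = 0"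
    using eventually_ge_at_top[of "2 ^ Suc n"]
  proof eventually_elim
    case (elim N)
    have N: "block n \<subseteq> {..<N}" using elim by (auto simp: block_def)
    have n: "n < N" using less_le_trans[OF less_exp, of "n" N] elim by simp
    have "(\<Otimes>i\<in>{..<N}. w i [^] (if i \<in> block n then 1 else (0::int))) = s n"
      using finprod_indicator_pow[of w "block n" N "\<lambda>_. 1", OF _ finite_block N]
      by (simp add: carriers s_def)
    moreover have "(\<Otimes>i\<in>{..<N}. g i [^] (if i \<in> {n} then 1 else (0::int))) = g n"
      using finprod_indicator_pow[of g "{n}" N "\<lambda>_. 1"] n by (simp add: carriers)
    ultimately show ?case
      using N n by (auto simp: word_def m_comm carriers)
  qed
  show "\<forall>i<m. (if i \<in> block n then 1 else 0 :: int) = 0 \<and> (if i \<in> {n} then 1 else 0 :: int) = 0"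
    using assms less_of_block by fastforce
  show "\<forall>n'. \<forall>i\<in>block n' - {}. (if i \<in> block n then 1 else 0 :: int) = (if n' \<in> {n} then 1 else 0)"
    using block_disjoint by auto
qed auto

lemma expansion_of_A: "a \<in> A m \<Longrightarrow> \<exists>d c E. expansion 1 m a d c E"
  by (erule A.cases) (use expansion_w_power expansion_g_s expansion_inv in blast)+

lemma expansion_of_prods: "x \<in> prods (\<lambda>_. m) k \<Longrightarrow> \<exists>d c E. expansion k m x d c E"
proof (induction k arbitrary: x)
  case 0
  then show ?case using expansion_one by auto
next
  case (Suc k)
  then obtain y a where y: "y \<in> prods (\<lambda>_. m) k" and a: "a \<in> A m" and x: "x = y \<otimes> a"
    unfolding in_prods_Suc by blast
  obtain d c E d' c' E' where "expansion k m y d c E" "expansion 1 m a d' c' E'"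
    using Suc.IH[OF y] expansion_of_A[OF a] by blast
  from expansion_mult[OF this] show ?case unfolding x by auto
qed

text \<open>A block \<open>n \<ge> m \<ge> k\<close> has \<open>2 ^ n > k\<close> indices, so the exceptional set \<open>E\<close> cannot contain
  all of them, and \<open>c n\<close> survives as the exponent of some \<open>w i\<close> of the block.\<close>

lemma expansion_coeff_nonzero:
  assumes "expansion k m x d c E" "k \<le> m" "c n \<noteq> 0"
  shows "\<exists>i. n < i \<and> d i \<noteq> 0"
proof -
  have "m \<le> n" using assms by (force simp: expansion_def not_less[symmetric])
  moreover have "card E \<le> k" using assms by (simp add: expansion_def)
  moreover have "n < card (block n)" by (simp add: card_block)
  ultimately have "card E < card (block n)" using assms(2) by linarith
  moreover have "finite E" using assms by (simp add: expansion_def)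
  ultimately obtain i where i: "i \<in> block n" "i \<notin> E"
    using card_mono[of E "block n"] by fastforce
  then have "d i = c n" using assms(1) unfolding expansion_def by blast
  then show ?thesis using assms(3) less_of_block[OF i(1)] by metis
qed

text \<open>Consider the last index \<open>l\<close> with \<open>d l \<noteq> 0\<close>. By \<open>expansion_coeff_nonzero\<close> no \<open>g n\<close> with \<open>n > l\<close>
  occurs. As \<open>x = g m\<close> with \<open>m \<le> l\<close>, solving for \<open>w l [^] d l\<close> puts it in the subgroup generated
  by the earlier elements, although \<open>\<bar>d l\<bar>\<close> is below the order of \<open>w l\<close> modulo that subgroup.\<close>

lemma expansion_trivial:
  assumes exp: "expansion k m x d c E" and km: "k \<le> m" and x: "x = g m"
  shows "d i = 0"
proof (rule ccontr)
  assume "d i \<noteq> 0"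
  obtain N0 where N0: "\<And>N. N \<ge> N0 \<Longrightarrow> x = word N d c \<and> d N = 0 \<and> c N = 0"
    using exp by (auto simp: expansion_def eventually_sequentially)
  have fin: "finite {i. d i \<noteq> 0}"
    by (rule finite_subset[of _ "{..<N0}"]) (use N0 not_less in auto)
  define l where "l = Max {i. d i \<noteq> 0}"
  have l: "d l \<noteq> 0" and l_max: "\<And>i. l < i \<Longrightarrow> d i = 0"
    using Max_in[OF fin] Max_ge[OF fin] \<open>d i \<noteq> 0\<close> unfolding l_def by (auto simp: not_le[symmetric])
  have ml: "m \<le> l" using l exp by (force simp: expansion_def not_less[symmetric])
  have c: "c n = 0" if "l < n" for n
    using expansion_coeff_nonzero[OF exp km, of n] l_max that less_trans by blast
  define H where "H = generate G (w ` {..<l} \<union> g ` {..l})"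
  have H: "subgroup H G" unfolding H_def by (rule generate_is_subgroup) (use carriers in auto)
  have wH: "w i \<in> H" if "i < l" for i unfolding H_def using that by (intro generate.incl) auto
  have gH: "g i \<in> H" if "i \<le> l" for i unfolding H_def using that by (intro generate.incl) auto
  define N where "N = max N0 (Suc l)"
  define P where "P = (\<Otimes>i\<in>{..<l}. w i [^] d i)"
  define Q where "Q = (\<Otimes>i\<in>{..<N}. g i [^] c i)"
  have P: "P \<in> H" unfolding P_def
    by (rule subgroup_finprod_closed[OF H]) (auto intro: subgroup_int_pow_closed[OF H] wH)
  have Q: "Q \<in> H" unfolding Q_def
  proof (rule subgroup_finprod_closed[OF H])
    show "g i [^] c i \<in> H" for i
      using c[of i] gH[of i] subgroup_int_pow_closed[OF H] subgroup.one_closed[OF H] by (cases "i \<le> l") auto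
  qed
  have "(\<Otimes>i\<in>{..<N}. w i [^] d i) = (\<Otimes>i\<in>{..<Suc l}. w i [^] d i)"
    by (rule finprod_mono_neutral_cong_right) (auto simp: N_def carriers l_max)
  also have "\<dots> = w l [^] d l \<otimes> P"
    unfolding P_def lessThan_Suc by (rule finprod_insert) (auto simp: carriers)
  finally have "x = (w l [^] d l \<otimes> P) \<otimes> Q"
    using N0[of N] by (simp add: word_def Q_def N_def)
  moreover have "P \<in> carrier G" "Q \<in> carrier G" using P Q subgroup.mem_carrier[OF H] by auto
  ultimately have "w l [^] d l = x \<otimes> inv (P \<otimes> Q)"
    using inv_solve_right[of "w l [^] d l" x "P \<otimes> Q"] by (simp add: carriers m_assoc)
  then have wlH: "w l [^] d l \<in> H"
    using P Q gH[OF ml] x by (simp add: subgroup.m_closed[OF H] subgroup.m_inv_closed[OF H])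
  then have "w l [^] (- d l) \<in> H"
    using subgroup.m_inv_closed[OF H] by (simp add: int_pow_neg carriers)
  with wlH have "w l [^] \<bar>d l\<bar> \<in> H" by (simp add: abs_if)
  then have "w l [^] nat \<bar>d l\<bar> \<in> H"
    by (metis abs_ge_zero int_nat_eq int_pow_int)
  moreover have "nat \<bar>d l\<bar> \<le> l * (l * l + 1)"
  proof -
    have "\<bar>d l\<bar> \<le> int (k * (l * l + 1))" using exp unfolding expansion_def by blast
    moreover have "k * (l * l + 1) \<le> l * (l * l + 1)" using km ml by (intro mult_right_mono) auto
    ultimately show ?thesis by linarith
  qed
  ultimately show False using w_independent[of "nat \<bar>d l\<bar>" l] l unfolding H_def by simp
qed

text \<open>The index \<open>m\<close> is one at which \<open>g\<close> takes the value \<open>x\<close>, so that \<open>x\<close> counts as an earlier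
  element for all \<open>w i\<close> with \<open>i \<ge> m\<close>.\<close>

lemma prods_separated:
  assumes x: "x \<in> carrier G" "x \<noteq> \<one>"
  shows "\<exists>m. x \<notin> prods (\<lambda>_. m) k"
proof -
  obtain m where m: "k \<le> m" "g m = x" using g_recurrent[OF x(1)] by blast
  have "x \<notin> prods (\<lambda>_. m) k"
  proof
    assume "x \<in> prods (\<lambda>_. m) k"
    then obtain d c E where exp: "expansion k m x d c E" using expansion_of_prods by blast
    have d: "d i = 0" for i using expansion_trivial[OF exp] m by simp
    then have c: "c n = 0" for n using expansion_coeff_nonzero[OF exp m(1)] by blast
    obtain N where "x = word N d c"
      using exp eventually_happens'[OF sequentially_bot] unfolding expansion_def by blast
    moreover have "d = (\<lambda>_. 0)" "c = (\<lambda>_. 0)" using d c by auto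
    ultimately show False using x(2) word_zero by simp
  qed
  then show ?thesis by blast
qed

lemma continuous_character_A_small:
  assumes h: "h \<in> continuous_characters G nbhd_topology" and "\<epsilon> > 0"
  shows "\<exists>m. \<forall>a\<in>A m. norm (h a - 1) < \<epsilon>"
proof -
  have hom: "h \<in> hom G circle_group"
    and cont: "continuous_map nbhd_topology (top_of_set (sphere 0 1)) h"
    using h by (auto simp: continuous_characters_def)
  have h1: "h \<one> = 1"
    using hom_one[OF hom] comm_group_circle_group
    by (simp add: circle_group_def comm_group.axioms(2) is_group)
  define U where "U = {x \<in> topspace nbhd_topology. h x \<in> sphere 0 1 \<inter> ball 1 \<epsilon>}"
  have "openin nbhd_topology U"
    unfolding U_def by (rule openin_continuous_map_preimage[OF cont]) (simp add: openin_open_Int)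
  moreover have "\<one> \<in> U" using h1 \<open>\<epsilon> > 0\<close> by (simp add: U_def topspace_nbhd_topology)
  ultimately obtain f where "\<one> <# nbhd f \<subseteq> U" unfolding openin_nbhd_topology by blast
  moreover have "A (f 0) \<subseteq> \<one> <# nbhd f"
    using A_subset_nbhd[of f] in_carrier_nbhd by (force simp: l_coset_def)
  ultimately have "norm (h a - 1) < \<epsilon>" if "a \<in> A (f 0)" for a
    using that by (auto simp: U_def dist_norm norm_minus_commute)
  then show ?thesis by blast
qed

text \<open>Infinitely many \<open>n\<close> satisfy \<open>g n = x\<close>. For these, \<open>h x\<close> is the quotient of \<open>h (g n \<otimes> s n)\<close>
  and \<open>h (s n)\<close>, which both tend to 1.\<close>

lemma continuous_character_trivial:
  assumes h: "h \<in> continuous_characters G nbhd_topology" and x: "x \<in> carrier G"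
  shows "h x = 1"
proof -
  have hom: "h \<in> hom G circle_group" using h by (auto simp: continuous_characters_def)
  have h_mult: "h (a \<otimes> b) = h a * h b" if "a \<in> carrier G" "b \<in> carrier G" for a b
    using hom_mult[OF hom that] by (simp add: circle_group_def)
  have h_norm: "norm (h a) = 1" if "a \<in> carrier G" for a
    using hom_in_carrier[OF hom that] by (simp add: circle_group_def)
  have h1: "h \<one> = 1"
    using h_mult[of \<one> \<one>] h_norm[of \<one>] by auto
  have h_pow: "h (a [^] n) = h a ^ n" if "a \<in> carrier G" for a and n :: nat
    by (induction n) (auto simp: h1 h_mult that)
  have h_prod: "h (finprod G w I) = (\<Prod>i\<in>I. h (w i))" if "finite I" for I
    using that by induction (auto simp: h1 h_mult carriers)
  have close: "norm (h x - 1) \<le> \<epsilon>" if "\<epsilon> > 0" for \<epsilon> :: real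
  proof -
    obtain m1 where m1: "\<And>a. a \<in> A m1 \<Longrightarrow> norm (h a - 1) < 1 / 2"
      using continuous_character_A_small[OF h, of "1 / 2"] by auto
    obtain m2 where m2: "\<And>a. a \<in> A m2 \<Longrightarrow> norm (h a - 1) < \<epsilon> / 2"
      using continuous_character_A_small[OF h, of "\<epsilon> / 2"] \<open>\<epsilon> > 0\<close> by auto
    obtain m3 where m3: "(1 / 2) ^ m3 < \<epsilon> / 2"
      using real_arch_pow_inv[of "\<epsilon> / 2" "1 / 2"] \<open>\<epsilon> > 0\<close> by auto
    obtain n where n: "max m1 (max m2 m3) \<le> n" "g n = x" using g_recurrent[OF x] by blast
    have w_close: "norm (h (w i) - 1) \<le> 1 / 4 ^ n" if i: "i \<in> block n" for i
    proof -
      have ni: "n < i" using i by (rule less_of_block)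
      have "norm (h (w i) ^ j - 1) \<le> 1 / 2" if "j \<le> i * i" for j
      proof -
        have "int j \<le> int (i * i)" using that by (rule of_nat_mono)
        then have "w i [^] int j \<in> A m1" using ni n(1) by (intro A.w_power) auto
        then have "norm (h (w i [^] j) - 1) < 1 / 2" using m1 by (simp add: int_pow_int)
        then show ?thesis by (simp add: h_pow carriers)
      qed
      then have "norm (h (w i) - 1) \<le> 1 / real (i * i)"
        using ni by (intro norm_diff_one_le_of_powers) auto
      also have "\<dots> \<le> 1 / 4 ^ n"
      proof -
        have "(2::nat) ^ n * 2 ^ n \<le> i * i" using i by (intro mult_mono) (auto simp: block_def)
        then have "real (2 ^ n * 2 ^ n) \<le> real (i * i)" by (rule of_nat_mono)
        then have "4 ^ n \<le> real (i * i)" by (simp add: power_mult_distrib[symmetric])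
        then show ?thesis by (intro divide_left_mono) (use ni in auto)
      qed
      finally show ?thesis .
    qed
    have "norm (h (s n) - 1) = norm ((\<Prod>i\<in>block n. h (w i)) - (\<Prod>i\<in>block n. 1))"
      by (simp add: s_def h_prod finite_block)
    also have "\<dots> \<le> (\<Sum>i\<in>block n. norm (h (w i) - 1))"
      by (rule norm_prod_diff) (auto simp: h_norm carriers)
    also have "\<dots> \<le> real (card (block n)) * (1 / 4 ^ n)"
      by (rule sum_bounded_above) (use w_close in auto)
    also have "\<dots> = (1 / 2) ^ n"
    proof -
      have "(4::real) ^ n = 2 ^ n * 2 ^ n" by (simp add: power_mult_distrib[symmetric])
      then show ?thesis by (simp add: card_block power_one_over)
    qed
    also have "\<dots> \<le> (1 / 2) ^ m3" using n(1) by (intro power_decreasing) auto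
    finally have s_close: "norm (h (s n) - 1) < \<epsilon> / 2" using m3 by simp
    have "g n \<otimes> s n \<in> A m2" using n(1) by (intro A.g_s) auto
    then have gs_close: "norm (h x * h (s n) - 1) < \<epsilon> / 2"
      using m2[of "g n \<otimes> s n"] h_mult[of x "s n"] x n(2) by (simp add: carriers)
    have "norm (h x - 1) = norm ((h x - 1) * h (s n))" by (simp add: norm_mult h_norm carriers)
    also have "\<dots> = norm ((h x * h (s n) - 1) - (h (s n) - 1))" by (simp add: algebra_simps)
    also have "\<dots> \<le> norm (h x * h (s n) - 1) + norm (h (s n) - 1)" by (rule norm_triangle_ineq4)
    finally show ?thesis using s_close gs_close by simp
  qed
  have "norm (h x - 1) \<le> 0" by (rule field_le_epsilon) (use close in auto)
  then show ?thesis by simp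
qed

lemma minimally_almost_periodic_nbhd_topology: "minimally_almost_periodic G nbhd_topology"
proof -
  have "(\<lambda>_. 1) \<in> continuous_characters G nbhd_topology"
    by (auto simp: continuous_characters_def hom_def circle_group_def)
  then show ?thesis
    using continuous_character_trivial
    unfolding minimally_almost_periodic_def von_neumann_radical_def kernel_def
    by (auto simp: circle_group_def)
qed

end

section \<open>Existence of the topology\<close>

theorem corollary1:
  fixes G :: "('a, 'b) monoid_scheme"
  assumes "comm_group G"
    and "countable (carrier G)" and "infinite (carrier G)"
    and "torsion_group G"
    and "unbounded_group G"
  shows "\<exists>T. topological_ab_group G T \<and> Hausdorff_space T \<and>
             complete_group_topology G T \<and> minimally_almost_periodic G T"
proof -
  interpret comm_group G by fact
  have torsion: "\<exists>n::nat. n > 0 \<and> x [^]\<^bsub>G\<^esub> n = \<one>\<^bsub>G\<^esub>" if "x \<in> carrier G" for x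
    using assms(4) that by (auto simp: torsion_group_def)
  have unbounded: "\<not> (\<exists>n::nat. n > 0 \<and> (\<forall>x\<in>carrier G. x [^]\<^bsub>G\<^esub> n = \<one>\<^bsub>G\<^esub>))"
    using assms(5) unbounded_group_iff by blast
  \<comment> \<open>Decoding \<open>n\<close> as a pair and dropping its second component repeats every element infinitely
      often.\<close>
  define g where "g n = from_nat_into (carrier G) (fst (prod_decode n))" for n
  have g: "g n \<in> carrier G" for n unfolding g_def by (rule from_nat_into) auto
  have recurrent: "\<exists>n\<ge>m. g n = x" if "x \<in> carrier G" for x m
  proof -
    obtain p where p: "from_nat_into (carrier G) p = x"
      using from_nat_into_surj[OF assms(2) \<open>x \<in> carrier G\<close>] by blast
    have "m \<le> prod_encode (p, m)" by (rule le_prod_encode_2)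
    moreover have "g (prod_encode (p, m)) = x" by (simp add: g_def p)
    ultimately show ?thesis by blast
  qed
  obtain w where w: "\<And>i. w i \<in> carrier G"
      "\<And>i j. 0 < j \<Longrightarrow> j \<le> i * (i * i + 1) \<Longrightarrow>
         w i [^]\<^bsub>G\<^esub> (j::nat) \<notin> generate G (w ` {..<i} \<union> g ` {..i})"
    using exists_sequence_large_orders[where g = g and B = "\<lambda>i. i * (i * i + 1)",
        OF torsion unbounded g] by blast
  interpret sparse_sequence G g w
    by unfold_locales (use g w recurrent in auto)
  show ?thesis
    using topological_ab_group_nbhd_topology Hausdorff_nbhd_topology[OF prods_separated]
      complete_nbhd_topology[OF assms(2)] minimally_almost_periodic_nbhd_topology
    by blast
qed

end
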